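(* For any positive integer $d$ there exists a constant $C(d)>0$ such that $$|\mathrm{Hom}(P_{n,d},0)|=C(d)\,\lambda(d)^{n/2}(1+o(1))\quad\text{as }n\to\infty,$$ where $\lambda(d)$ is the unique positive solution $\lambda$ of the equation $\lambda^{d-1/2}(\lambda-2)=1$.
   Context: For $n,d\ge 1$, $P_{n,d}$ is the graph with vertex set $\{0,1,\dots,n\}$ in which $i,j$ are adjacent iff $|i-j|\in\{1,3,\dots,2d+1\}$. $\mathrm{Hom}(P_{n,d},0)$ is the finite set of functions $f\colon\{0,\dots,n\}\to\mathbb{Z}$ with $f(0)=0$ and $|f(i)-f(j)|=1$ whenever $i,j$ are adjacent in $P_{n,d}$. *)

theory Defs
  imports Complex_Main "HOL-Library.FuncSet" "HOL-Library.Landau_Symbols"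
begin

definition P_vertices :: "nat \<Rightarrow> nat set" where
  "P_vertices n = {0..n}"

definition P_adj :: "nat \<Rightarrow> nat \<Rightarrow> nat \<Rightarrow> nat \<Rightarrow> bool" where
  "P_adj n d i j \<longleftrightarrow>
     i \<in> P_vertices n \<and> j \<in> P_vertices n \<and>
     \<bar>int i - int j\<bar> \<in> {2 * int k + 1 | k. k \<le> d}"

(* Extensional functions (value undefined outside the vertex set) make the elements
   correspond one-to-one to functions on {0..n}, so that card counts them correctly. *)
definition Hom_P :: "nat \<Rightarrow> nat \<Rightarrow> (nat \<Rightarrow> int) set" where
  "Hom_P n d =
     {f \<in> P_vertices n \<rightarrow>\<^sub>E UNIV. f 0 = 0 \<and> (\<forall>i j. P_adj n d i j \<longrightarrow> \<bar>f i - f j\<bar> = 1)}"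

definition is_growth_root :: "nat \<Rightarrow> real \<Rightarrow> bool" where
  "is_growth_root d l \<longleftrightarrow> l > 0 \<and> l powr (real d - 1 / 2) * (l - 2) = 1"

definition growth_root :: "nat \<Rightarrow> real" where
  "growth_root d = (THE l. is_growth_root d l)"

end

(* Record a homomorphism f by the sign f 1 and the set S = {i. f (i - 1) \<noteq> f (i + 1)}.
   The edge conditions say exactly that elements of S at odd distance are at distance at least
   2 d + 1. The numbers b m of such subsets of {1..m} satisfy
   b (m + 2) = 2 b m + b (m + 1 - 2 d), with truncated subtraction. After normalisation by the
   positive characteristic root, every term is a fixed convex combination of the terms 2 and
   2 d + 1 places before; as these steps are coprime, the oscillation contracts geometrically
   and the sequence converges to a positive limit. *)
theory Submission imports Defs begin

section \<open>Spaced sets\<close>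

text \<open>\<open>S\<close> is meant to hold the places at which a homomorphism moves on in the
  same direction instead of stepping back.\<close>

definition spaced :: "nat \<Rightarrow> nat set \<Rightarrow> bool" where
  "spaced d S \<longleftrightarrow> (\<forall>i\<in>S. \<forall>j\<in>S. i < j \<longrightarrow> odd (j - i) \<longrightarrow> 2 * d + 1 \<le> j - i)"

definition spaced_sets :: "nat \<Rightarrow> nat \<Rightarrow> nat set set" where
  "spaced_sets d m = {S. S \<subseteq> {1..m} \<and> spaced d S}"

lemma spacedD: "spaced d S \<Longrightarrow> i \<in> S \<Longrightarrow> j \<in> S \<Longrightarrow> i < j \<Longrightarrow> odd (j - i) \<Longrightarrow> 2 * d + 1 \<le> j - i"
  by (auto simp: spaced_def)

lemma finite_spaced_sets [simp]: "finite (spaced_sets d m)"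
  by (rule finite_subset[of _ "Pow {1..m}"]) (auto simp: spaced_sets_def)

lemma card_spaced_sets_pos: "card (spaced_sets d m) > 0"
proof -
  have "{} \<in> spaced_sets d m" by (simp add: spaced_sets_def spaced_def)
  then show ?thesis using card_gt_0_iff finite_spaced_sets by blast
qed

lemma spaced_insert_above:
  assumes "\<And>t. t \<in> T \<Longrightarrow> t < x"
  shows "spaced d (insert x T) \<longleftrightarrow> spaced d T \<and> (\<forall>t\<in>T. odd (x - t) \<longrightarrow> 2 * d + 1 \<le> x - t)"
  using assms unfolding spaced_def by (auto simp del: even_diff_nat dest: less_asym)

text \<open>A spaced set meets the last \<open>2 d - 1\<close> places in a single parity class. Hence it
  can be extended by at least one of \<open>m + 1\<close> and \<open>m + 2\<close>, and by both
  (separately) exactly when it avoids these places.\<close>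

lemma card_spaced_sets_rec:
  assumes d: "d \<ge> 1"
  shows "card (spaced_sets d (m + 2)) = 2 * card (spaced_sets d m) + card (spaced_sets d (m + 1 - 2 * d))"
proof -
  \<comment> \<open>\<open>ext x\<close> holds the sets that stay spaced when a new place
    \<open>x > m\<close> is added.\<close>
  define ext where "ext x = {T \<in> spaced_sets d m. \<forall>t\<in>T. odd (x - t) \<longrightarrow> 2 * d + 1 \<le> x - t}" for x
  let ?V = "spaced_sets d"
  have fin: "finite (ext x)" for x unfolding ext_def by simp
  have un: "ext (m + 1) \<union> ext (m + 2) = ?V m"
  proof -
    have overlap: False if T: "T \<in> ?V m" and t: "t \<in> T" "odd (m + 1 - t)" "m + 1 - t < 2 * d + 1"
      and s: "s \<in> T" "odd (m + 2 - s)" "m + 2 - s < 2 * d + 1" for T s t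
    proof -
      have sp: "spaced d T" and le: "t \<le> m" "s \<le> m"
        using T t s by (auto simp: spaced_sets_def)
      consider "s < t" "odd (t - s)" | "t < s" "odd (s - t)"
        using t(2) s(2) le by (cases s t rule: linorder_cases) auto
      then show False
        using spacedD[OF sp s(1) t(1)] spacedD[OF sp t(1) s(1)] t(3) s(3) le by cases linarith+
    qed
    have "T \<in> ext (m + 1) \<or> T \<in> ext (m + 2)" if "T \<in> ?V m" for T
      using overlap[OF that] that unfolding ext_def mem_Collect_eq by (meson not_le)
    then show ?thesis unfolding ext_def by blast
  qed
  \<comment> \<open>Extendability by either place bans both parities from the last places. If
    \<open>m + 1 \<le> 2 * d\<close>, truncation gives an empty range, and indeed only the empty set
    is left.\<close>
  have int: "ext (m + 1) \<inter> ext (m + 2) = ?V (m + 1 - 2 * d)"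
  proof (intro equalityI subsetI)
    fix T assume T: "T \<in> ext (m + 1) \<inter> ext (m + 2)"
    have "t \<in> {1..m + 1 - 2 * d}" if "t \<in> T" for t
    proof -
      have t: "1 \<le> t" "t \<le> m" using T that by (auto simp: ext_def spaced_sets_def)
      have "odd (m + 1 - t) \<longrightarrow> 2 * d + 1 \<le> m + 1 - t" "odd (m + 2 - t) \<longrightarrow> 2 * d + 1 \<le> m + 2 - t"
        using T that by (auto simp: ext_def)
      moreover have "odd (m + 1 - t) \<or> odd (m + 2 - t)" using t by auto
      ultimately have "2 * d + 1 \<le> m + 2 - t" using t by linarith
      then show ?thesis using t by auto
    qed
    then show "T \<in> ?V (m + 1 - 2 * d)" using T by (auto simp: ext_def spaced_sets_def)
  next
    fix T assume T: "T \<in> ?V (m + 1 - 2 * d)"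
    have "t \<le> m \<and> 2 * d + 1 \<le> m + 2 - t \<and> (odd (m + 1 - t) \<longrightarrow> 2 * d + 1 \<le> m + 1 - t)"
      if "t \<in> T" for t
    proof -
      have "t \<in> {1..m + 1 - 2 * d}" using T that by (auto simp: spaced_sets_def)
      then have t: "1 \<le> t" "t + 2 * d \<le> m + 1" by auto
      \<comment> \<open>The bound just obtained still allows distance exactly \<open>2 * d\<close>
        from \<open>m + 1\<close>; parity excludes it.\<close>
      have "odd (m + 1 - t) \<longrightarrow> m + 1 - t \<noteq> 2 * d" by (metis dvd_triv_left)
      then show ?thesis using t d by auto
    qed
    then show "T \<in> ext (m + 1) \<inter> ext (m + 2)" using T
      by (fastforce simp: ext_def spaced_sets_def)
  qed
  have insert_mem: "insert x T \<in> ?V (m + 2)"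
    if "T \<in> ext x" "x \<in> {m + 1, m + 2}" for x T
    using that spaced_insert_above[of T x d] by (fastforce simp: ext_def spaced_sets_def)
  \<comment> \<open>The two new places are at odd distance 1, so no spaced set contains both. This
    leaves three disjoint classes: neither, only \<open>m + 1\<close>, only
    \<open>m + 2\<close>.\<close>
  have sub: "?V (m + 2) \<subseteq> ?V m \<union> insert (m + 1) ` ext (m + 1) \<union> insert (m + 2) ` ext (m + 2)"
  proof
    fix S assume S: "S \<in> ?V (m + 2)"
    have sub: "S \<subseteq> {1..m + 2}" and sp: "spaced d S" using S by (auto simp: spaced_sets_def)
    have notboth: "m + 1 \<notin> S \<or> m + 2 \<notin> S"
      using spacedD[OF sp, of "m + 1" "m + 2"] d by auto
    have mem: "S - {x} \<in> ext x" if x: "x \<in> S" "S - {x} \<subseteq> {1..m}" "x > m" for x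
    proof -
      have "spaced d (insert x (S - {x}))" using sp x by (simp add: insert_absorb)
      then show ?thesis using x spaced_insert_above[of "S - {x}" x d]
        by (fastforce simp: ext_def spaced_sets_def)
    qed
    have rest: "z \<in> {1..m}" if "z \<in> S" "z \<noteq> m + 1" "z \<noteq> m + 2" for z
    proof -
      have "z \<in> {1..m + 2}" using that(1) sub by blast
      then show ?thesis using that by auto
    qed
    consider "m + 1 \<in> S" | "m + 2 \<in> S" | "m + 1 \<notin> S" "m + 2 \<notin> S" by blast
    then show "S \<in> ?V m \<union> insert (m + 1) ` ext (m + 1) \<union> insert (m + 2) ` ext (m + 2)"
    proof cases
      case 1
      have "S - {m + 1} \<subseteq> {1..m}" using rest notboth 1 by blast
      then have "S - {m + 1} \<in> ext (m + 1)" by (intro mem 1) auto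
      moreover have "S = insert (m + 1) (S - {m + 1})" using 1 by auto
      ultimately show ?thesis by blast
    next
      case 2
      have "S - {m + 2} \<subseteq> {1..m}" using rest notboth 2 by blast
      then have "S - {m + 2} \<in> ext (m + 2)" by (intro mem 2) auto
      moreover have "S = insert (m + 2) (S - {m + 2})" using 2 by auto
      ultimately show ?thesis by blast
    next
      case 3
      have "S \<subseteq> {1..m}" using rest 3 by blast
      then show ?thesis using sp by (simp add: spaced_sets_def)
    qed
  qed
  have V: "?V (m + 2) = ?V m \<union> insert (m + 1) ` ext (m + 1) \<union> insert (m + 2) ` ext (m + 2)"
  proof (rule antisym[OF sub])
    have "?V m \<subseteq> ?V (m + 2)" by (auto simp: spaced_sets_def)
    then show "?V m \<union> insert (m + 1) ` ext (m + 1) \<union> insert (m + 2) ` ext (m + 2) \<subseteq> ?V (m + 2)"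
      using insert_mem by blast
  qed
  have above: "x \<notin> T" if "T \<in> ?V m" "x > m" for T x using that by (auto simp: spaced_sets_def)
  have inj: "inj_on (insert x) (ext x)" if "x > m" for x
    using that above by (intro inj_onI) (metis (lifting) ext_def insert_ident mem_Collect_eq)
  have disj: "?V m \<inter> insert (m + 1) ` ext (m + 1) = {}"
    "(?V m \<union> insert (m + 1) ` ext (m + 1)) \<inter> insert (m + 2) ` ext (m + 2) = {}"
    using above by (auto simp: ext_def) (metis (no_types) insertCI insertE less_add_Suc1 n_not_Suc_n less_SucI lessI)+
  have "card (?V (m + 2)) = card (?V m) + card (ext (m + 1)) + card (ext (m + 2))"
    unfolding V using disj fin inj by (simp add: card_Un_disjoint card_image)
  \<comment> \<open>Inclusion-exclusion: the two \<open>ext\<close> families have union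
    \<open>?V m\<close> and intersection \<open>?V (m + 1 - 2 * d)\<close>.\<close>
  also have "\<dots> = 2 * card (?V m) + card (?V (m + 1 - 2 * d))"
    using card_Un_Int[OF fin fin, of "m + 1" "m + 2"] unfolding un int by simp
  finally show ?thesis .
qed

section \<open>Homomorphisms as spaced sets\<close>

text \<open>Rebuilds the homomorphism from its record: \<open>s\<close> is the first step, and at
  each place the walk steps back unless the place is in \<open>S\<close>, where
  \<open>2 * x - y\<close> repeats the previous step.\<close>

fun walk :: "int \<Rightarrow> nat set \<Rightarrow> nat \<Rightarrow> int" where
  "walk s S 0 = 0"
| "walk s S (Suc 0) = s"
| "walk s S (Suc (Suc n)) = (if Suc n \<in> S then 2 * walk s S (Suc n) - walk s S n else walk s S n)"

lemma walk_step: "\<bar>s\<bar> = 1 \<Longrightarrow> \<bar>walk s S (Suc n) - walk s S n\<bar> = 1"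
  by (induction n) (auto simp: abs_minus_commute)

lemma walk_turn_iff: "\<bar>s\<bar> = 1 \<Longrightarrow> walk s S (Suc (Suc n)) = walk s S n \<longleftrightarrow> Suc n \<notin> S"
  using walk_step[of s S n] by auto

lemma walk_const:
  assumes "\<And>j. j < k \<Longrightarrow> i + 2 * j + 1 \<notin> S"
  shows "walk s S (i + 2 * k) = walk s S i"
  using assms by (induction k) auto

text \<open>Of the two parity classes of places strictly between \<open>i\<close> and
  \<open>i + 2 * k + 1\<close>, at least one is free of \<open>S\<close>, as elements of both would
  be at odd distance below \<open>2 * d + 1\<close>. Along a free class the walk is constant in
  steps of 2, so a single unit step remains.\<close>

lemma walk_odd_diff:
  assumes s: "\<bar>s\<bar> = 1" and sp: "spaced d S" and k: "k \<le> d"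
  shows "\<bar>walk s S (i + 2 * k + 1) - walk s S i\<bar> = 1"
proof (cases "\<exists>j<k. i + 2 * j + 1 \<in> S")
  case False
  then have "walk s S (i + 2 * k) = walk s S i" by (intro walk_const) auto
  then show ?thesis using walk_step[OF s, of S "i + 2 * k"] by simp
next
  case True
  then obtain a where a: "a < k" "i + 2 * a + 1 \<in> S" by blast
  have "(i + 1) + 2 * b + 1 \<notin> S" if "b < k" for b
  proof
    assume b: "(i + 1) + 2 * b + 1 \<in> S"
    show False
    proof (cases "a \<le> b")
      case True
      then show False using spacedD[OF sp a(2) b] that k by auto
    next
      case False
      then show False using spacedD[OF sp b a(2)] a(1) k by auto
    qed
  qed
  then have "walk s S ((i + 1) + 2 * k) = walk s S (i + 1)" by (rule walk_const)
  then show ?thesis using walk_step[OF s, of S i] by (simp add: algebra_simps)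
qed

lemma P_adj_offset:
  "P_adj n d (i + 2 * k + 1) i \<longleftrightarrow> i + 2 * k + 1 \<le> n \<and> k \<le> d"
  by (auto simp: P_adj_def P_vertices_def)

lemma P_adjE:
  assumes "P_adj n d i j"
  obtains k where "k \<le> d" "j = i + 2 * k + 1" "j \<le> n" | k where "k \<le> d" "i = j + 2 * k + 1" "i \<le> n"
proof -
  obtain k where k: "k \<le> d" "\<bar>int i - int j\<bar> = 2 * int k + 1" "i \<le> n" "j \<le> n"
    using assms by (auto simp: P_adj_def P_vertices_def)
  then have "j = i + 2 * k + 1 \<or> i = j + 2 * k + 1" by linarith
  then show ?thesis using that k by blast
qed

lemma Hom_PD:
  assumes "f \<in> Hom_P n d" "i + 2 * k + 1 \<le> n" "k \<le> d"
  shows "\<bar>f (i + 2 * k + 1) - f i\<bar> = 1"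
  using assms P_adj_offset[of n d i k] by (auto simp: Hom_P_def)

lemma restrict_walk_Hom_P:
  assumes s: "\<bar>s\<bar> = 1" and S: "spaced d S"
  shows "restrict (walk s S) {0..n} \<in> Hom_P n d"
  unfolding Hom_P_def
proof (intro CollectI conjI allI impI)
  show "restrict (walk s S) {0..n} \<in> P_vertices n \<rightarrow>\<^sub>E UNIV" by (auto simp: P_vertices_def)
  show "restrict (walk s S) {0..n} 0 = 0" by simp
  fix i j assume "P_adj n d i j"
  then show "\<bar>restrict (walk s S) {0..n} i - restrict (walk s S) {0..n} j\<bar> = 1"
  proof (cases rule: P_adjE)
    case (1 k)
    then show ?thesis using walk_odd_diff[OF s S, of k i] by (simp add: abs_minus_commute)
  next
    case (2 k)
    then show ?thesis using walk_odd_diff[OF s S, of k j] by simp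
  qed
qed

text \<open>If \<open>i < j\<close> were at odd distance below \<open>2 * d + 1\<close>, each of
  \<open>i - 1\<close>, \<open>i + 1\<close> would be adjacent to each of \<open>j - 1\<close>,
  \<open>j + 1\<close>. Two distinct values at distance 1 from a common value have it as midpoint,
  so \<open>f (j - 1) = f (j + 1)\<close>, a contradiction.\<close>

lemma Hom_P_turns_spaced:
  assumes f: "f \<in> Hom_P n d"
  shows "spaced d {i \<in> {1..n - 1}. f (i + 1) \<noteq> f (i - 1)}"
  unfolding spaced_def
proof (intro ballI impI)
  fix i j assume i: "i \<in> {i \<in> {1..n - 1}. f (i + 1) \<noteq> f (i - 1)}"
    and j: "j \<in> {i \<in> {1..n - 1}. f (i + 1) \<noteq> f (i - 1)}" and ij: "i < j" "odd (j - i)"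
  show "2 * d + 1 \<le> j - i"
  proof (rule ccontr)
    assume "\<not> ?thesis"
    moreover obtain k where "j - i = 2 * k + 1" using ij(2) by (rule oddE)
    ultimately have k: "j = i + 2 * k + 1" "k < d" using ij by auto
    obtain h where h: "i = Suc h" using i by (cases i) auto
    have n: "h + 2 * k + 3 \<le> n" using j k h by auto
    have "\<bar>f (h + 2 * k + 1) - f h\<bar> = 1" using Hom_PD[OF f, of h k] n k by simp
    moreover have "\<bar>f (h + 2 * k + 3) - f h\<bar> = 1"
      using Hom_PD[OF f, of h "k + 1"] n k by (simp add: algebra_simps numeral_eq_Suc)
    moreover have "\<bar>f (h + 2 * k + 3) - f (h + 2)\<bar> = 1"
      using Hom_PD[OF f, of "h + 2" k] n k by (simp add: algebra_simps numeral_eq_Suc)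
    moreover have "\<bar>f (h + 2 * k + 1) - f (h + 2)\<bar> = 1"
    \<comment> \<open>For \<open>k = 0\<close> the vertex \<open>j - 1\<close> precedes
      \<open>i + 1\<close>, so the edge must be read in the other direction.\<close>
    proof (cases k)
      case 0
      then show ?thesis using Hom_PD[OF f, of "h + 1" 0] n k
        by (simp add: algebra_simps numeral_eq_Suc abs_minus_commute)
    next
      case (Suc l)
      then show ?thesis using Hom_PD[OF f, of "h + 2" l] n k
        by (simp add: algebra_simps numeral_eq_Suc)
    qed
    moreover have "f (h + 2) \<noteq> f h" "f (h + 2 * k + 3) \<noteq> f (h + 2 * k + 1)"
      using i j k h by (auto simp: algebra_simps numeral_eq_Suc)
    ultimately show False by linarith
  qed
qed

text \<open>Steps have size 1, so \<open>f (i + 2)\<close> is either \<open>f i\<close> or its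
  mirror image in \<open>f (i + 1)\<close>, and \<open>S\<close> records which.\<close>

lemma Hom_P_eq_walk:
  assumes f: "f \<in> Hom_P n d" and i: "i \<le> n"
  defines "S \<equiv> {i \<in> {1..n - 1}. f (i + 1) \<noteq> f (i - 1)}"
  shows "f i = walk (f 1) S i"
  using i
proof (induction i rule: induct_nat_012)
  case 0
  then show ?case using f by (simp add: Hom_P_def)
next
  case 1
  then show ?case by simp
next
  case (ge2 i)
  have "\<bar>f (Suc i) - f i\<bar> = 1" "\<bar>f (Suc (Suc i)) - f (Suc i)\<bar> = 1"
    using Hom_PD[OF f, of i 0] Hom_PD[OF f, of "Suc i" 0] ge2.prems by auto
  then have "f (Suc (Suc i)) \<noteq> f i \<Longrightarrow> f (Suc (Suc i)) = 2 * f (Suc i) - f i" by linarith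
  moreover have "Suc i \<in> S \<longleftrightarrow> f (Suc (Suc i)) \<noteq> f i" using ge2.prems by (auto simp: S_def)
  moreover have "walk (f 1) S i = f i" "walk (f 1) S (Suc i) = f (Suc i)" using ge2 by auto
  ultimately show ?case by (auto simp del: One_nat_def)
qed

text \<open>The factor 2 counts the signs of the first step; membership in \<open>S\<close> concerns
  only the \<open>m\<close> interior vertices.\<close>

lemma card_Hom_P_Suc: "card (Hom_P (Suc m) d) = 2 * card (spaced_sets d m)"
proof -
  let ?n = "Suc m"
  let ?F = "\<lambda>(s, S). restrict (walk s S) {0..?n}"
  have "bij_betw ?F ({1, -1} \<times> spaced_sets d m) (Hom_P ?n d)"
    unfolding bij_betw_def
  proof
    show "inj_on ?F ({1, -1} \<times> spaced_sets d m)"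
    proof (rule inj_onI, clarify)
      fix s s' :: int and S S'
      assume s: "s \<in> {1, -1}" and s': "s' \<in> {1, -1}"
        and S: "S \<in> spaced_sets d m" and S': "S' \<in> spaced_sets d m"
        and eq: "restrict (walk s S) {0..?n} = restrict (walk s' S') {0..?n}"
      have w: "walk s S i = walk s' S' i" if "i \<le> ?n" for i
        using fun_cong[OF eq, of i] that by simp
      have "Suc i \<in> S \<longleftrightarrow> Suc i \<in> S'" if "Suc i \<le> m" for i
        using walk_turn_iff[of s S i] walk_turn_iff[of s' S' i] s s' w[of i] w[of "Suc (Suc i)"] that
        by (auto simp del: walk.simps)
      then have "i \<in> S \<longleftrightarrow> i \<in> S'" if "i \<in> {1..m}" for i
        using that by (cases i) auto
      then have "S = S'" using S S' unfolding spaced_sets_def by blast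
      then show "s = s' \<and> S = S'" using w[of 1] by simp
    qed
    show "?F ` ({1, -1} \<times> spaced_sets d m) = Hom_P ?n d"
    proof (intro equalityI subsetI)
      fix f assume "f \<in> ?F ` ({1, -1} \<times> spaced_sets d m)"
      then show "f \<in> Hom_P ?n d"
        by (auto simp: spaced_sets_def intro!: restrict_walk_Hom_P)
    next
      fix f assume f: "f \<in> Hom_P ?n d"
      define S where "S = {i \<in> {1..?n - 1}. f (i + 1) \<noteq> f (i - 1)}"
      \<comment> \<open>Off the vertex set both functions are \<open>undefined\<close>, so they
        agree everywhere.\<close>
      have "f = restrict (walk (f 1) S) {0..?n}"
      proof
        fix i show "f i = restrict (walk (f 1) S) {0..?n} i"
          using Hom_P_eq_walk[OF f, of i] f
          by (cases "i \<le> ?n") (auto simp: S_def Hom_P_def P_vertices_def PiE_def extensional_def)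
      qed
      moreover have "S \<in> spaced_sets d m"
        using Hom_P_turns_spaced[OF f] by (auto simp: S_def spaced_sets_def)
      moreover have "f 1 \<in> {1, -1}"
        using Hom_PD[OF f, of 0 0] f by (auto simp: Hom_P_def)
      ultimately show "f \<in> ?F ` ({1, -1} \<times> spaced_sets d m)" by force
    qed
  qed
  then have "card (Hom_P ?n d) = card ({1, -1 :: int} \<times> spaced_sets d m)"
    by (simp add: bij_betw_same_card)
  then show ?thesis by (simp add: card_cartesian_product)
qed

section \<open>Averaging recurrences\<close>

text \<open>To be used with \<open>p = 2 * r ^ 2\<close> and \<open>q = r ^ (2 * d + 1)\<close>,
  where \<open>r\<close> is the inverse square root of the growth root; \<open>p + q = 1\<close> is
  then the characteristic equation.\<close>

locale averaging =
  fixes p q :: real and d :: nat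
  assumes p: "p > 0" and q: "q > 0" and pq: "p + q = 1" and d: "d \<ge> 1"
begin

definition avg :: "(nat \<Rightarrow> real) \<Rightarrow> bool" where
  "avg u \<longleftrightarrow> (\<forall>n. u (n + 2 * d + 1) = p * u (n + 2 * d - 1) + q * u n)"

lemma avg_shift: "avg u \<Longrightarrow> avg (\<lambda>n. u (n + k))"
  unfolding avg_def
proof
  fix n assume "\<forall>n. u (n + 2 * d + 1) = p * u (n + 2 * d - 1) + q * u n"
  from spec[OF this, of "n + k"] d
  show "u (n + 2 * d + 1 + k) = p * u (n + 2 * d - 1 + k) + q * u (n + k)"
    by (simp add: algebra_simps)
qed

text \<open>Constants solve the linear recurrence because \<open>p + q = 1\<close>. Reflection lets
  lower bounds serve as upper bounds.\<close>

lemma avg_reflect: "avg u \<Longrightarrow> avg (\<lambda>n. c - u n)"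
proof -
  assume u: "avg u"
  have "c - (p * x + q * y) = p * (c - x) + q * (c - y)" for x y
  proof -
    have "c = (p + q) * c" using pq by simp
    then show ?thesis by (simp add: algebra_simps)
  qed
  then show ?thesis using u unfolding avg_def by simp
qed

text \<open>A minimum principle: bounds on one window of \<open>2 * d + 1\<close> terms persist,
  since the weights are positive.\<close>

lemma avg_nonneg:
  assumes "avg u" "\<And>k. k \<le> 2 * d \<Longrightarrow> 0 \<le> u k"
  shows "0 \<le> u k"
proof (induction k rule: less_induct)
  case (less k)
  show ?case
  proof (cases "k \<le> 2 * d")
    case False
    then obtain n where n: "k = n + 2 * d + 1" by (metis add.commute add.left_commute less_iff_Suc_add not_le Suc_eq_plus1)
    have "u k = p * u (n + 2 * d - 1) + q * u n" using assms(1) n by (simp add: avg_def)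
    moreover have "0 \<le> u (n + 2 * d - 1)" "0 \<le> u n" using less n by auto
    ultimately show ?thesis using p q by simp
  qed (use assms in simp)
qed

text \<open>The indices \<open>2 a + 2 d + 1\<close> and \<open>2 a + 4 d + 2\<close> with \<open>a \<le> 2 d\<close>
  cover a whole window, on which the initial term therefore has a positive weight.\<close>

lemma avg_spread:
  assumes u: "avg u" and nn: "\<And>k. 0 \<le> u k" and t: "4 * d + 2 \<le> t" "t \<le> 6 * d + 2"
  shows "p ^ (2 * d) * q ^ 2 * u 0 \<le> u t"
proof -
  have q1: "q * u n \<le> u (n + 2 * d + 1)" for n
    using u nn[of "n + 2 * d - 1"] p by (simp add: avg_def)
  have p1: "p * u (n + 2 * d - 1) \<le> u (n + 2 * d + 1)" for n
    using u nn[of n] q by (simp add: avg_def)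
  have pa: "p ^ a * u (n + 2 * d + 1) \<le> u (n + 2 * d + 1 + 2 * a)" for a n
  proof (induction a)
    case (Suc a)
    have "p * (p ^ a * u (n + 2 * d + 1)) \<le> p * u (n + 2 * d + 1 + 2 * a)"
      using Suc p by (intro mult_left_mono) auto
    also have "\<dots> \<le> u (n + 2 * d + 1 + 2 * Suc a)"
      using p1[of "n + 2 + 2 * a"] d by (simp add: algebra_simps)
    finally show ?case by (simp add: algebra_simps)
  qed simp
  have p_le: "p ^ (2 * d) \<le> p ^ a" if "a \<le> 2 * d" for a
    using that p q pq by (intro power_decreasing) auto
  have "q ^ 2 \<le> q" using p q pq by (simp add: power2_eq_square mult_left_le)
  \<comment> \<open>One long step of length \<open>2 * d + 1\<close> reaches odd indices, two reach
    even ones. The weight \<open>q\<close> of the single step is lowered to \<open>q ^ 2\<close> so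
    that both parities share one bound.\<close>
  have two: "q ^ 2 * u 0 \<le> u (4 * d + 2)"
  proof -
    have "q * (q * u 0) \<le> q * u (0 + 2 * d + 1)" using q1[of 0] q by (intro mult_left_mono) auto
    also have "\<dots> \<le> u (4 * d + 2)" using q1[of "2 * d + 1"] by (simp add: algebra_simps)
    finally show ?thesis by (simp add: power2_eq_square)
  qed
  have one: "q ^ 2 * u 0 \<le> u (2 * d + 1)"
  proof -
    have "q ^ 2 * u 0 \<le> q * u 0" using \<open>q ^ 2 \<le> q\<close> nn by (intro mult_right_mono) auto
    then show ?thesis using q1[of 0] by simp
  qed
  have step: "p ^ (2 * d) * q ^ 2 * u 0 \<le> p ^ a * x" if "a \<le> 2 * d" "q ^ 2 * u 0 \<le> x" for a x
  proof -
    have "p ^ (2 * d) * (q ^ 2 * u 0) \<le> p ^ a * x"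
      using that p_le[of a] nn p by (intro mult_mono) auto
    then show ?thesis by (simp add: mult.assoc)
  qed
  show ?thesis
  proof (cases "even t")
    case True
    define a where "a = (t - (4 * d + 2)) div 2"
    have a: "t = 4 * d + 2 + 2 * a" "a \<le> 2 * d" using True t unfolding a_def by auto
    show ?thesis using step[OF a(2) two] pa[of a "2 * d + 1"] a(1) by (simp add: algebra_simps)
  next
    case False
    define a where "a = (t - (2 * d + 1)) div 2"
    have "even (t - (2 * d + 1))" using False t by auto
    then have a: "t = 2 * d + 1 + 2 * a" using t unfolding a_def by auto
    \<comment> \<open>An odd \<open>t\<close> is at most \<open>6 * d + 1\<close>, which is what
      keeps \<open>a\<close> in range.\<close>
    then have "a \<le> 2 * d" using t False by presburger
    then show ?thesis using step[OF _ one] pa[of a 0] a by fastforce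
  qed
qed

section \<open>Contraction of the oscillation and convergence\<close>

definition contraction :: real where "contraction = 1 - p ^ (2 * d) * q ^ 2 / 2"

lemma contraction_bounds: "0 \<le> contraction" "contraction < 1"
proof -
  have "p ^ (2 * d) * q ^ 2 \<le> 1" using p q pq by (intro mult_le_one power_le_one) auto
  then show "0 \<le> contraction" by (simp add: contraction_def)
  show "contraction < 1" using p q by (simp add: contraction_def)
qed

text \<open>\<open>1 - contraction\<close> is half the weight in \<open>avg_spread\<close>, because
  the initial term is only known to be at least half of \<open>D\<close>. The bound on the window
  then persists by \<open>avg_nonneg\<close>.\<close>

lemma avg_oscillation_half:
  assumes u: "avg u" and nn: "\<And>k. 0 \<le> u k" and half: "D / 2 \<le> u 0" and D: "D \<ge> 0"
  shows "(1 - contraction) * D \<le> u (k + (4 * d + 2))"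
proof -
  have window: "0 \<le> u (k + (4 * d + 2)) - (1 - contraction) * D" if "k \<le> 2 * d" for k
  proof -
    have "p ^ (2 * d) * q ^ 2 * (D / 2) \<le> p ^ (2 * d) * q ^ 2 * u 0"
      using half p q by (intro mult_left_mono) auto
    also have "\<dots> \<le> u (k + (4 * d + 2))" using that by (intro avg_spread[OF u nn]) auto
    finally show ?thesis by (simp add: contraction_def)
  qed
  have "avg (\<lambda>n. 0 - (((1 - contraction) * D) - u (n + (4 * d + 2))))"
    by (intro avg_reflect avg_shift u)
  then have "avg (\<lambda>n. u (n + (4 * d + 2)) - (1 - contraction) * D)" by simp
  from avg_nonneg[OF this window] show ?thesis by simp
qed

text \<open>If \<open>u 0\<close> lies in the upper half of the interval, the lower end can be
  raised; otherwise the reflected sequence shows that the upper end can be lowered.\<close>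

lemma avg_oscillation_step:
  assumes u: "avg u" and b: "\<And>k. lo \<le> u k \<and> u k \<le> lo + D"
  shows "\<exists>lo'. \<forall>k. lo' \<le> u (k + (4 * d + 2)) \<and> u (k + (4 * d + 2)) \<le> lo' + contraction * D"
proof -
  have D: "D \<ge> 0" using b[of 0] by simp
  show ?thesis
  proof (cases "u 0 \<ge> lo + D / 2")
    case True
    have "avg (\<lambda>n. 0 - (lo - u n))" by (intro avg_reflect u)
    then have "avg (\<lambda>n. u n - lo)" by simp
    from avg_oscillation_half[OF this _ _ D] have "(1 - contraction) * D \<le> u (k + (4 * d + 2)) - lo" for k
      using b True by (simp add: algebra_simps)
    then have "\<forall>k. lo + (1 - contraction) * D \<le> u (k + (4 * d + 2)) \<and>
      u (k + (4 * d + 2)) \<le> (lo + (1 - contraction) * D) + contraction * D"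
      using b by (simp add: algebra_simps)
    then show ?thesis by blast
  next
    case False
    have "avg (\<lambda>n. (lo + D) - u n)" by (intro avg_reflect u)
    from avg_oscillation_half[OF this _ _ D]
    have "(1 - contraction) * D \<le> lo + D - u (k + (4 * d + 2))" for k
      using b False by (simp add: algebra_simps)
    then have "\<forall>k. lo \<le> u (k + (4 * d + 2)) \<and> u (k + (4 * d + 2)) \<le> lo + contraction * D"
      using b by (simp add: algebra_simps)
    then show ?thesis by blast
  qed
qed

lemma avg_oscillation:
  assumes u: "avg u" and b: "\<And>k. lo \<le> u k \<and> u k \<le> lo + D"
  shows "\<exists>N lo'. \<forall>k. lo' \<le> u (k + N) \<and> u (k + N) \<le> lo' + contraction ^ j * D"
proof (induction j)
  case 0
  show ?case using b by (intro exI[of _ 0] exI[of _ lo]) simp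
next
  case (Suc j)
  then obtain N lo' where "\<And>k. lo' \<le> u (k + N) \<and> u (k + N) \<le> lo' + contraction ^ j * D" by blast
  from avg_oscillation_step[OF avg_shift[OF u] this]
  obtain lo'' where "\<forall>k. lo'' \<le> u (k + (4 * d + 2) + N) \<and>
    u (k + (4 * d + 2) + N) \<le> lo'' + contraction * (contraction ^ j * D)" by blast
  then show ?case by (intro exI[of _ "4 * d + 2 + N"] exI[of _ lo'']) (simp add: add.assoc mult.assoc)
qed

text \<open>The shrinking oscillation makes \<open>u\<close> Cauchy. The limit is positive because
  the minimum of the first window bounds all terms from below.\<close>

lemma avg_convergent:
  assumes u: "avg u" and pos: "\<And>k. u k > 0"
  shows "\<exists>L>0. u \<longlonglongrightarrow> L"
proof -
  define lo where "lo = Min (u ` {..2 * d})"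
  define hi where "hi = Max (u ` {..2 * d})"
  define D where "D = hi - lo"
  have lo: "lo > 0" unfolding lo_def using pos by (subst Min_gr_iff) auto
  have "avg (\<lambda>n. 0 - (lo - u n))" by (intro avg_reflect u)
  then have 1: "avg (\<lambda>n. u n - lo)" by simp
  have lo_le: "lo \<le> u k" for k using avg_nonneg[OF 1, of k] by (simp add: lo_def)
  have le_hi: "u k \<le> hi" for k using avg_nonneg[OF avg_reflect[OF u], of hi k] by (simp add: hi_def)
  have b: "lo \<le> u k \<and> u k \<le> lo + D" for k using lo_le le_hi by (simp add: D_def)
  have "Cauchy u"
  proof (rule metric_CauchyI)
    fix e :: real assume e: "0 < e"
    have "(\<lambda>j. contraction ^ j * D) \<longlonglongrightarrow> 0 * D"
      using contraction_bounds by (intro tendsto_intros LIMSEQ_realpow_zero) auto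
    then have "eventually (\<lambda>j. contraction ^ j * D < e) sequentially"
      using e by (intro order_tendstoD) auto
    then obtain j where j: "contraction ^ j * D < e" by (auto simp: eventually_sequentially)
    from avg_oscillation[OF u b, of j] obtain N lo'
      where N: "\<And>k. lo' \<le> u (k + N) \<and> u (k + N) \<le> lo' + contraction ^ j * D" by blast
    have "dist (u m) (u n) < e" if "m \<ge> N" "n \<ge> N" for m n
      using N[of "m - N"] N[of "n - N"] that j unfolding dist_real_def by (simp; linarith)
    then show "\<exists>M. \<forall>m\<ge>M. \<forall>n\<ge>M. dist (u m) (u n) < e" by blast
  qed
  then obtain L where L: "u \<longlonglongrightarrow> L" using Cauchy_convergent_iff convergent_def by blast
  moreover have "lo \<le> L" using L lo_le by (intro LIMSEQ_le_const) auto
  ultimately show ?thesis using lo by (intro exI[of _ L]) auto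
qed

end

section \<open>The growth root\<close>

lemma is_growth_root_gt_2:
  assumes "is_growth_root d l"
  shows "l > 2"
proof (rule ccontr)
  assume "\<not> l > 2"
  then have "l powr (real d - 1 / 2) * (l - 2) \<le> 0" by (intro mult_nonneg_nonpos) auto
  then show False using assms by (simp add: is_growth_root_def)
qed

text \<open>Beyond 2, where all roots lie, both factors are positive and strictly increasing. The
  product is 0 at 2 and at least 1 at 3.\<close>

lemma ex1_growth_root:
  assumes d: "d \<ge> 1"
  shows "\<exists>!l. is_growth_root d l"
proof -
  let ?g = "\<lambda>l::real. l powr (real d - 1 / 2) * (l - 2)"
  have less: "?g x < ?g y" if "2 < x" "x < y" for x y
    using that d by (intro mult_strict_mono powr_less_mono2) auto
  have "1 \<le> ?g 3" using d by (simp add: ge_one_powr_ge_zero)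
  then have "\<exists>l\<ge>2. l \<le> 3 \<and> ?g l = 1"
    by (intro IVT') (auto intro!: continuous_intros)
  then obtain l where "is_growth_root d l" by (force simp: is_growth_root_def)
  moreover have "x = y" if "is_growth_root d x" "is_growth_root d y" for x y
    using less[of x y] less[of y x] is_growth_root_gt_2[OF that(1)] is_growth_root_gt_2[OF that(2)] that
    by (cases x y rule: linorder_cases) (auto simp: is_growth_root_def)
  ultimately show ?thesis by blast
qed

lemma powr_minus_half_power:
  fixes l :: real
  assumes "l > 0"
  shows "(l powr (-1 / 2)) ^ k = l powr (- real k / 2)"
  using assms by (simp add: powr_powr flip: powr_realpow)

text \<open>Multiplying the equation of the root by \<open>l powr (- (2 * d + 1) / 2)\<close> leaves
  \<open>1 - 2 / l\<close> on one side and \<open>r ^ (2 * d + 1)\<close> on the other.\<close>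

lemma growth_root_char_eq:
  fixes l :: real
  assumes l: "is_growth_root d l"
  defines "r \<equiv> l powr (-1 / 2)"
  shows "2 * r ^ 2 + r ^ (2 * d + 1) = 1"
proof -
  have pos: "l > 0" and eq: "l powr (real d - 1 / 2) * (l - 2) = 1"
    using l by (auto simp: is_growth_root_def)
  have pw: "r ^ k = l powr (- real k / 2)" for k
    using pos unfolding r_def by (rule powr_minus_half_power)
  have "l powr (- real (2 * d + 1) / 2) = l powr (- real (2 * d + 1) / 2) * (l powr (real d - 1 / 2) * (l - 2))"
    using eq by simp
  also have "\<dots> = l powr (- real (2 * d + 1) / 2 + (real d - 1 / 2)) * (l - 2)"
    by (simp only: powr_add mult.assoc)
  also have "- real (2 * d + 1) / 2 + (real d - 1 / 2) = - 1" by (simp add: field_simps)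
  also have "l powr (- 1) * (l - 2) = 1 - 2 * l powr (- 1)"
    using pos by (simp add: powr_minus_divide diff_divide_distrib)
  finally show ?thesis unfolding pw by simp
qed

section \<open>Limit of the normalised counts and the asymptotic formula\<close>

theorem theorem2p10:
  fixes d :: nat
  assumes "d \<ge> 1"
  shows "(\<exists>!l. is_growth_root d l) \<and>
    (\<exists>C::real. C > 0 \<and>
      (\<lambda>n. real (card (Hom_P n d))) \<sim>[at_top] (\<lambda>n. C * growth_root d powr (real n / 2)))"
proof (intro conjI)
  show ex1: "\<exists>!l. is_growth_root d l" using assms by (rule ex1_growth_root)
  define l where "l = growth_root d"
  have root: "is_growth_root d l" unfolding l_def growth_root_def using ex1 by (rule theI')
  then have l: "l > 0" by (simp add: is_growth_root_def)
  define r where "r = l powr (-1 / 2)"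
  have r: "r > 0" using l by (simp add: r_def)
  have char_eq: "2 * r ^ 2 + r ^ (2 * d + 1) = 1"
    unfolding r_def using root by (rule growth_root_char_eq)
  interpret averaging "2 * r ^ 2" "r ^ (2 * d + 1)" d
    using r char_eq assms by unfold_locales auto
  define b where "b m = real (card (spaced_sets d m))" for m
  have "avg (\<lambda>m. b m * r ^ m)"
    unfolding avg_def
  proof
    fix n
    \<comment> \<open>With this \<open>k\<close> the truncated index \<open>k + 1 - 2 * d\<close> is
      exactly \<open>n\<close>, so the counts satisfy the untruncated recurrence.\<close>
    obtain k where k: "n + 2 * d + 1 = k + 2" "k = n + 2 * d - 1" "k + 1 - 2 * d = n"
      using assms by (intro that[of "n + 2 * d - 1"]) auto
    have "b (n + 2 * d + 1) = 2 * b k + b n"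
      unfolding b_def using card_spaced_sets_rec[OF assms, of k] k by simp
    moreover have "r ^ (n + 2 * d + 1) = r ^ 2 * r ^ k"
      unfolding k(1) power_add by (rule mult.commute)
    moreover have "r ^ (n + 2 * d + 1) = r ^ (2 * d + 1) * r ^ n"
      by (simp add: power_add)
    ultimately have "b (n + 2 * d + 1) * r ^ (n + 2 * d + 1) =
        2 * b k * (r ^ 2 * r ^ k) + b n * (r ^ (2 * d + 1) * r ^ n)"
      by (metis distrib_right)
    also have "\<dots> = 2 * r ^ 2 * (b k * r ^ k) + r ^ (2 * d + 1) * (b n * r ^ n)"
      by (simp only: mult_ac)
    finally show "b (n + 2 * d + 1) * r ^ (n + 2 * d + 1) =
      2 * r ^ 2 * (b (n + 2 * d - 1) * r ^ (n + 2 * d - 1)) + r ^ (2 * d + 1) * (b n * r ^ n)"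
      unfolding k(2) .
  qed
  moreover have "b m * r ^ m > 0" for m using r card_spaced_sets_pos by (simp add: b_def)
  ultimately obtain L where L: "L > 0" "(\<lambda>m. b m * r ^ m) \<longlonglongrightarrow> L" using avg_convergent by blast
  \<comment> \<open>The 2 comes from the sign of the first step, the extra \<open>r\<close> from the
    index shift between \<open>Hom_P (Suc m) d\<close> and \<open>spaced_sets d m\<close>.\<close>
  define C where "C = 2 * r * L"
  have C: "C > 0" using L r by (simp add: C_def)
  have "(\<lambda>m. 2 * r * (b m * r ^ m) / C) \<longlonglongrightarrow> 2 * r * L / C"
    using C by (intro tendsto_intros L) auto
  moreover have "2 * r * L / C = 1" using r L(1) by (simp add: C_def)
  moreover have "2 * r * (b m * r ^ m) / C =
    real (card (Hom_P (Suc m) d)) / (C * l powr (real (Suc m) / 2))" for m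
  proof -
    have "l powr (real (Suc m) / 2) = 1 / r ^ Suc m"
      unfolding r_def powr_minus_half_power[OF l]
      by (simp only: minus_divide_left[symmetric] powr_minus_divide) simp
    then show ?thesis unfolding card_Hom_P_Suc b_def by (simp only:) (use r in simp)
  qed
  ultimately have "(\<lambda>m. real (card (Hom_P (Suc m) d)) / (C * l powr (real (Suc m) / 2))) \<longlonglongrightarrow> 1"
    by (simp only:)
  then have "(\<lambda>n. real (card (Hom_P n d)) / (C * l powr (real n / 2))) \<longlonglongrightarrow> 1"
    by (rule LIMSEQ_imp_Suc)
  then have "(\<lambda>n. real (card (Hom_P n d))) \<sim>[at_top] (\<lambda>n. C * l powr (real n / 2))"
    by (rule asymp_equivI')
  then show "\<exists>C::real. C > 0 \<and>
      (\<lambda>n. real (card (Hom_P n d))) \<sim>[at_top] (\<lambda>n. C * growth_root d powr (real n / 2))"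
    using C unfolding l_def by blast
qed

end
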